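(* For every integer $m\geq 2$, \[ f(m)\geq \left\lfloor\frac{m}{2}\right\rfloor\left\lceil\frac{m}{2}\right\rceil=\left\lfloor\frac{m^2}{4}\right\rfloor, \] where $f(m)=\sup_{\mathbf{P}}\dim(\mathbf{P})/B(\mathbf{P})$, the supremum taken over all $m$-partite posets $\mathbf{P}$.
   Context: All posets are finite. The order dimension $\dim(\mathbf{Q})$ of a poset $\mathbf{Q}=(X,\preceq)$ is the least number $d$ of linear extensions $\preceq_1,\ldots,\preceq_d$ of $\preceq$ such that for all $x,y\in X$: $x\preceq y$ iff $x\preceq_i y$ for all $i\in[d]$. For an integer $m\geq 2$ and disjoint nonempty sets $X_1,\ldots,X_m$, $\mathbf{P}=(X_1,\ldots,X_m;\preceq)$ is an $m$-partite poset if $\preceq$ is a partial order on $X=X_1\cup\cdots\cup X_m$ such that (1) each $X_i$ is an antichain, and (2) $x\prec y$ implies $x\in X_i$, $y\in X_j$ with $i<j$. Its dimension is that of $(X,\preceq)$. For $i<j$, $\mathbf{P}_{i,j}$ is the sub-poset induced on $X_i\cup X_j$, and $B(\mathbf{P})=\max_{i<j}\dim(\mathbf{P}_{i,j})$. *)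

theory Defs
  imports Complex_Main "HOL-Library.Disjoint_Sets" "HOL-Library.Extended_Real"
begin

definition linear_extension :: "'a set \<Rightarrow> 'a rel \<Rightarrow> 'a rel \<Rightarrow> bool" where
  "linear_extension X r L \<longleftrightarrow> linear_order_on X L \<and> r \<subseteq> L"

definition realizer :: "'a set \<Rightarrow> 'a rel \<Rightarrow> nat \<Rightarrow> (nat \<Rightarrow> 'a rel) \<Rightarrow> bool" where
  "realizer X r d L \<longleftrightarrow>
     (\<forall>i\<in>{1..d}. linear_extension X r (L i)) \<and>
     (\<forall>x\<in>X. \<forall>y\<in>X. (x, y) \<in> r \<longleftrightarrow> (\<forall>i\<in>{1..d}. (x, y) \<in> L i))"

text \<open>A realizer by zero linear extensions exists only when \<open>X\<close> has at most one element,
  so the dimension of a poset with two or more elements is positive.\<close>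

definition order_dim :: "'a set \<Rightarrow> 'a rel \<Rightarrow> nat" where
  "order_dim X r = (LEAST d. \<exists>L. realizer X r d L)"

definition parts_union :: "nat \<Rightarrow> (nat \<Rightarrow> 'a set) \<Rightarrow> 'a set" where
  "parts_union m X = (\<Union>i\<in>{1..m}. X i)"

text \<open>The parts are \<open>X 1, \<dots>, X m\<close>; the values of \<open>X\<close> at other indices play no role.\<close>

definition multipartite_poset :: "nat \<Rightarrow> (nat \<Rightarrow> 'a set) \<Rightarrow> 'a rel \<Rightarrow> bool" where
  "multipartite_poset m X r \<longleftrightarrow>
     2 \<le> m \<and>
     (\<forall>i\<in>{1..m}. finite (X i) \<and> X i \<noteq> {}) \<and>
     disjoint_family_on X {1..m} \<and>
     partial_order_on (parts_union m X) r \<and>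
     (\<forall>i\<in>{1..m}. \<forall>x\<in>X i. \<forall>y\<in>X i. (x, y) \<in> r \<longrightarrow> x = y) \<and>
     (\<forall>x y. (x, y) \<in> r \<and> x \<noteq> y \<longrightarrow>
        (\<exists>i\<in>{1..m}. \<exists>j\<in>{1..m}. i < j \<and> x \<in> X i \<and> y \<in> X j))"

definition multipartite_dim :: "nat \<Rightarrow> (nat \<Rightarrow> 'a set) \<Rightarrow> 'a rel \<Rightarrow> nat" where
  "multipartite_dim m X r = order_dim (parts_union m X) r"

definition pair_dim :: "(nat \<Rightarrow> 'a set) \<Rightarrow> 'a rel \<Rightarrow> nat \<Rightarrow> nat \<Rightarrow> nat" where
  "pair_dim X r i j = order_dim (X i \<union> X j) (Restr r (X i \<union> X j))"

definition max_pair_dim :: "nat \<Rightarrow> (nat \<Rightarrow> 'a set) \<Rightarrow> 'a rel \<Rightarrow> nat" where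
  "max_pair_dim m X r = Max {pair_dim X r i j | i j. i \<in> {1..m} \<and> j \<in> {1..m} \<and> i < j}"

text \<open>Every finite poset is isomorphic to one whose carrier consists of natural numbers, so
  the supremum over all \<open>m\<close>-partite posets may be taken over those with elements of type
  \<open>nat\<close>. It is formed in the extended reals, hence exists without any boundedness assumption.\<close>

definition dim_ratio_sup :: "nat \<Rightarrow> ereal" where
  "dim_ratio_sup m =
     (SUP (X, r) \<in> {(X :: nat \<Rightarrow> nat set, r). multipartite_poset m X r}.
        ereal (real (multipartite_dim m X r) / real (max_pair_dim m X r)))"

end

theory Submission
  imports Defs
begin

text \<open>Put \<open>k = \<lfloor>m/2\<rfloor>\<close>, \<open>l = \<lceil>m/2\<rceil>\<close> and take the standard example \<open>S\<^sub>n\<close>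
  (\<open>a\<^sub>i < b\<^sub>j\<close> iff \<open>i \<noteq> j\<close>) with \<open>n = 2kl\<close>, whose dimension is \<open>n\<close>. Distribute the
  \<open>a\<^sub>i\<close> over the \<open>k\<close> lower parts and the \<open>b\<^sub>i\<close> over the \<open>l\<close> upper parts so that every pair
  of a lower and an upper part contains exactly two of the pairs \<open>(a\<^sub>i, b\<^sub>i)\<close>. Only those two
  pairs are incomparable across the parts, and two linear extensions realize such a poset.
  Hence the ratio is at least \<open>2kl / 2 = kl\<close>.\<close>

section \<open>Standard examples on sets of naturals and their realizers\<close>

definition std_rel :: "nat set \<Rightarrow> nat rel" where
  "std_rel Y = {(x, y). x \<in> Y \<and> y \<in> Y \<and> (x = y \<or> even x \<and> odd y \<and> x div 2 \<noteq> y div 2)}"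
  \<comment> \<open>The number \<open>2 i\<close> stands for \<open>a\<^sub>i\<close> and \<open>2 i + 1\<close> for \<open>b\<^sub>i\<close>.\<close>

lemma std_rel_Restr: "Z \<subseteq> Y \<Longrightarrow> Restr (std_rel Y) Z = std_rel Z"
  by (auto simp: std_rel_def)

lemma partial_order_on_std_rel: "partial_order_on Y (std_rel Y)"
  unfolding partial_order_on_def preorder_on_def
  by (auto simp: std_rel_def refl_on_def trans_def antisym_def)

lemma linear_order_on_key:
  fixes f :: "'a \<Rightarrow> int"
  assumes "inj_on f Y"
  shows "linear_order_on Y {(x, y). x \<in> Y \<and> y \<in> Y \<and> f x \<le> f y}"
  using assms
  unfolding linear_order_on_def partial_order_on_def preorder_on_def
  by (auto simp: refl_on_def trans_def antisym_def total_on_def inj_on_def)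

text \<open>Describing linear extensions by injective integer keys reduces the later case analyses
  to linear arithmetic.\<close>

lemma realizer_by_keys:
  fixes f :: "nat \<Rightarrow> 'a \<Rightarrow> int"
  assumes sub: "r \<subseteq> Y \<times> Y"
    and inj: "\<And>i. i \<in> {1..d} \<Longrightarrow> inj_on (f i) Y"
    and mono: "\<And>i x y. i \<in> {1..d} \<Longrightarrow> (x, y) \<in> r \<Longrightarrow> f i x \<le> f i y"
    and rev: "\<And>x y. x \<in> Y \<Longrightarrow> y \<in> Y \<Longrightarrow> (x, y) \<notin> r \<Longrightarrow> \<exists>i\<in>{1..d}. f i y < f i x"
  shows "realizer Y r d (\<lambda>i. {(x, y). x \<in> Y \<and> y \<in> Y \<and> f i x \<le> f i y})"
  unfolding realizer_def linear_extension_def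
proof (intro conjI ballI)
  fix x y assume "x \<in> Y" "y \<in> Y"
  then show "(x, y) \<in> r \<longleftrightarrow>
      (\<forall>i\<in>{1..d}. (x, y) \<in> {(x, y). x \<in> Y \<and> y \<in> Y \<and> f i x \<le> f i y})"
    using mono rev[of x y] by fastforce
qed (use linear_order_on_key[OF inj] sub mono in auto)

text \<open>In the \<open>i\<close>-th extension \<open>b\<close> precedes \<open>a\<close> for the index \<open>e i\<close>, all other \<open>a\<close>'s come
  before and all other \<open>b\<close>'s after these two. The auxiliary order \<open>g\<close> of the indices has
  \<open>e 1\<close> on top and \<open>e 2\<close> at the bottom, so that moving the exceptional pair does not disturb
  the reversal of the two antichains between the first and the second extension.\<close>

lemma std_rel_realizer:
  fixes Y :: "nat set" and e :: "nat \<Rightarrow> nat"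
  assumes fin: "finite Y" and q: "2 \<le> q" and e: "inj_on e {1..q}"
    and M: "\<And>i. 2 * i \<in> Y \<Longrightarrow> 2 * i + 1 \<in> Y \<Longrightarrow> i \<in> e ` {1..q}"
  shows "\<exists>L. realizer Y (std_rel Y) q L"
proof -
  obtain N where N: "\<And>y. y \<in> Y \<Longrightarrow> y < N"
    using fin finite_nat_set_iff_bounded by auto
  \<comment> \<open>\<open>int N\<close> and \<open>-1\<close> lie outside the range of indices in
    \<open>Y\<close>, so \<open>g\<close> stays injective on these.\<close>
  define g :: "nat \<Rightarrow> int"
    where "g j = (if j = e 1 then int N else if j = e 2 then -1 else int j)" for j
  \<comment> \<open>The sign makes extension 2 run through both antichains opposite to extension
    1.\<close>
  define s :: "nat \<Rightarrow> int" where "s i = (if i = 1 then 1 else -1)" for i :: nat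
  \<comment> \<open>On \<open>Y\<close>, \<open>g\<close> ranges from \<open>-1\<close> to
    \<open>int N\<close>, so the shift by \<open>int N + 5\<close> keeps ordinary keys below -1 or
    above 0. The values -1 and 0 remain for the exceptional pair.\<close>
  define f :: "nat \<Rightarrow> nat \<Rightarrow> int" where "f i x =
    (if even x then (if x div 2 = e i then 0 else s i * g (x div 2) - int N - 5)
     else (if x div 2 = e i then -1 else int N + 5 - s i * g (x div 2)))" for i x
  have e12: "e 1 \<noteq> e 2"
    using inj_onD[OF e, of 1 2] q by auto
  have g_bound: "-1 \<le> g (x div 2) \<and> g (x div 2) \<le> int N" if "x \<in> Y" for x
    using N[OF that] by (auto simp: g_def)
  have g_inj: "x div 2 = y div 2" if "g (x div 2) = g (y div 2)" "x \<in> Y" "y \<in> Y" for x y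
    using that N[of x] N[of y] by (auto simp: g_def split: if_splits)
  have g_top: "g (x div 2) < g (e 1)" if "x \<in> Y" "x div 2 \<noteq> e 1" for x
    using N[OF that(1)] that by (auto simp: g_def)
  have g_bot: "g (e 2) < g (x div 2)" if "x \<in> Y" "x div 2 \<noteq> e 2" for x
    using N[OF that(1)] that e12 by (auto simp: g_def)
  have eqI: "x = y" if "x div 2 = y div 2" "even x = even y" for x y :: nat
    using that by presburger
  have s_cases: "s i = 1 \<or> s i = -1" for i by (simp add: s_def)
  have f_even: "f i x \<le> -2 \<or> f i x = 0" "f i x = 0 \<longleftrightarrow> x div 2 = e i"
    if "x \<in> Y" "even x" for i x
    using g_bound[OF that(1)] s_cases[of i] that(2) by (auto simp: f_def)
  have f_odd: "f i x \<ge> 2 \<or> f i x = -1" "f i x = -1 \<longleftrightarrow> x div 2 = e i"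
    if "x \<in> Y" "odd x" for i x
    using g_bound[OF that(1)] s_cases[of i] that(2) by (auto simp: f_def)
  have f1_even: "f 1 u < f 1 v"
    if "u \<in> Y" "v \<in> Y" "even u" "even v" "g (u div 2) < g (v div 2)" for u v
    using that g_top[of u] g_top[of v] g_bound[of u] g_bound[of v]
    by (cases "u div 2 = e 1"; cases "v div 2 = e 1") (auto simp: f_def s_def)
  have f2_even: "f 2 v < f 2 u"
    if "u \<in> Y" "v \<in> Y" "even u" "even v" "g (u div 2) < g (v div 2)" for u v
    using that g_bot[of u] g_bot[of v] g_bound[of u] g_bound[of v]
    by (cases "u div 2 = e 2"; cases "v div 2 = e 2") (auto simp: f_def s_def)
  have f1_odd: "f 1 v < f 1 u"
    if "u \<in> Y" "v \<in> Y" "odd u" "odd v" "g (u div 2) < g (v div 2)" for u v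
    using that g_top[of u] g_top[of v] g_bound[of u] g_bound[of v]
    by (cases "u div 2 = e 1"; cases "v div 2 = e 1") (auto simp: f_def s_def)
  have f2_odd: "f 2 u < f 2 v"
    if "u \<in> Y" "v \<in> Y" "odd u" "odd v" "g (u div 2) < g (v div 2)" for u v
    using that g_bot[of u] g_bot[of v] g_bound[of u] g_bound[of v]
    by (cases "u div 2 = e 2"; cases "v div 2 = e 2") (auto simp: f_def s_def)
  have inj: "inj_on (f i) Y" for i
  proof (rule inj_onI)
    fix x y assume xy: "x \<in> Y" "y \<in> Y" "f i x = f i y"
    have par: "even x = even y"
      using f_even(1)[of x i] f_odd(1)[of x i] f_even(1)[of y i] f_odd(1)[of y i] xy by linarith
    have "x div 2 = y div 2"
    proof (cases "x div 2 = e i \<or> y div 2 = e i")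
      case True
      then show ?thesis
        using f_even(2)[of x i] f_odd(2)[of x i] f_even(2)[of y i] f_odd(2)[of y i] xy par
        by (cases "even x") auto
    next
      case False
      then have "g (x div 2) = g (y div 2)"
        using xy(3) par s_cases[of i] by (auto simp: f_def split: if_splits)
      then show ?thesis using g_inj xy by blast
    qed
    with par show "x = y" by (rule eqI[rotated])
  qed
  have mono: "f i x \<le> f i y" if "(x, y) \<in> std_rel Y" for i x y
  proof (cases "x = y")
    case False
    with that have *: "x \<in> Y" "y \<in> Y" "even x" "odd y" "x div 2 \<noteq> y div 2"
      by (auto simp: std_rel_def)
    \<comment> \<open>A larger key at \<open>x\<close> than at \<open>y\<close> could only mean keys
      0 and -1, hence the common index \<open>e i\<close>, which the relation excludes.\<close>
    show ?thesis
      using f_even[OF *(1,3), of i] f_odd[OF *(2,4), of i] *(5) by linarith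
  qed simp
  have rev: "\<exists>i\<in>{1..q}. f i y < f i x"
    if x: "x \<in> Y" and y: "y \<in> Y" and nr: "(x, y) \<notin> std_rel Y" for x y
  proof -
    have ne: "x \<noteq> y" using x nr by (auto simp: std_rel_def)
    have in12: "?thesis" if "f 1 y < f 1 x \<or> f 2 y < f 2 x"
      using that q by auto
    have cmp: "g (x div 2) < g (y div 2) \<or> g (y div 2) < g (x div 2)" if "even x = even y"
      using g_inj[OF _ x y] eqI[OF _ that] ne linorder_neqE by blast
    consider "even x" "even y" | "odd x" "odd y" | "odd x" "even y" | "even x" "odd y"
      by blast
    then show ?thesis
    proof cases
      case 1
      show ?thesis
        using cmp 1 f1_even[OF x y] f1_even[OF y x] f2_even[OF x y] f2_even[OF y x]
        by (intro in12) blast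
    next
      case 2
      show ?thesis
        using cmp 2 f1_odd[OF x y] f1_odd[OF y x] f2_odd[OF x y] f2_odd[OF y x]
        by (intro in12) blast
    next
      case 3
      \<comment> \<open>A b whose index is not \<open>e i\<close> lies above all a's in extension
        \<open>i\<close>; as \<open>e 1\<close> and \<open>e 2\<close> differ, one of the first two
        extensions works.\<close>
      obtain i where i: "i = 1 \<or> i = 2" "x div 2 \<noteq> e i" using e12 by metis
      then have "f i x \<ge> 2" using f_odd[OF x 3(1), of i] by blast
      moreover have "f i y \<le> 0" using f_even(1)[OF y 3(2), of i] by linarith
      ultimately have "f i y < f i x" by linarith
      with i(1) show ?thesis by (intro in12) blast
    next
      case 4
      \<comment> \<open>An unrelated a and b share their index, so \<open>M\<close> names the
        extension that reverses them.\<close>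
      then have eq: "x div 2 = y div 2" using nr x y by (auto simp: std_rel_def)
      have "2 * (x div 2) = x" "2 * (x div 2) + 1 = y" using 4 eq by presburger+
      then have "2 * (x div 2) \<in> Y" "2 * (x div 2) + 1 \<in> Y" using x y by (simp_all only:)
      then obtain i where i: "i \<in> {1..q}" "x div 2 = e i"
        using M by blast
      then have "f i y < f i x" using 4 eq by (auto simp: f_def)
      with i show ?thesis by blast
    qed
  qed
  show ?thesis
    by (rule exI, rule realizer_by_keys[of _ Y q f, OF _ inj mono rev])
      (auto simp: std_rel_def)
qed

text \<open>Guarantees that some realizer exists, so that the \<open>LEAST\<close> in
  \<open>order_dim\<close> is attained. Pairs are counted from 0 and extensions from 1, hence the
  shift \<open>i - 1\<close>.\<close>

lemma std_rel_realizer_lessThan: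
  assumes "finite Y" "2 \<le> q" and less: "\<And>i. 2 * i \<in> Y \<Longrightarrow> i < q"
  shows "\<exists>L. realizer Y (std_rel Y) q L"
proof (rule std_rel_realizer[OF assms(1,2)])
  show "inj_on (\<lambda>i. i - 1) {1..q}" by (auto simp: inj_on_def)
  show "i \<in> (\<lambda>i. i - 1) ` {1..q}" if "2 * i \<in> Y" for i
    using less[OF that] by (intro image_eqI[of _ _ "Suc i"]) auto
qed

section \<open>Bounds on the dimension\<close>

text \<open>Every pair must be reversed somewhere, and no extension reverses two of them:
  \<open>a\<^sub>i < b\<^sub>j < a\<^sub>j < b\<^sub>i\<close> would put the pair of index
  \<open>i\<close> back in order. The rest is the pigeonhole principle.\<close>

lemma std_rel_realizer_ge:
  assumes R: "realizer {..<2 * n} (std_rel {..<2 * n}) d L"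
  shows "n \<le> d"
proof -
  have "\<exists>i\<in>{1..d}. (2 * j, 2 * j + 1) \<notin> L i" if "j < n" for j
  proof -
    have "(2 * j, 2 * j + 1) \<notin> std_rel {..<2 * n}" by (simp add: std_rel_def)
    moreover have "2 * j \<in> {..<2 * n}" "2 * j + 1 \<in> {..<2 * n}" using that by auto
    ultimately show ?thesis using R unfolding realizer_def by blast
  qed
  then obtain h where h: "\<And>j. j < n \<Longrightarrow> h j \<in> {1..d} \<and> (2 * j, 2 * j + 1) \<notin> L (h j)"
    by metis
  have "inj_on h {..<n}"
  proof (rule inj_onI, rule ccontr)
    fix i j assume ij: "i \<in> {..<n}" "j \<in> {..<n}" "h i = h j" "i \<noteq> j"
    have lin: "linear_order_on {..<2 * n} (L (h i))" and ext: "std_rel {..<2 * n} \<subseteq> L (h i)"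
      using R h[of i] ij by (auto simp: realizer_def linear_extension_def)
    have "trans (L (h i))" and "total_on {..<2 * n} (L (h i))"
      using lin by (auto simp: linear_order_on_def partial_order_on_def preorder_on_def)
    moreover have "(2 * j + 1, 2 * j) \<in> L (h i)"
      using \<open>total_on _ _\<close>[unfolded total_on_def, rule_format, of "2 * j" "2 * j + 1"] h[of j] ij
      by auto
    moreover have "(2 * i, 2 * j + 1) \<in> L (h i)" "(2 * j, 2 * i + 1) \<in> L (h i)"
      using ext ij by (auto simp: std_rel_def)
    ultimately have "(2 * i, 2 * i + 1) \<in> L (h i)" by (meson transD)
    with h[of i] ij show False by auto
  qed
  moreover have "h ` {..<n} \<subseteq> {1..d}" using h by auto
  ultimately have "card {..<n} \<le> card {1..d}" by (intro card_inj_on_le) auto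
  then show ?thesis by simp
qed

lemma order_dim_std_rel_ge:
  assumes "2 \<le> n"
  shows "n \<le> order_dim {..<2 * n} (std_rel {..<2 * n})"
proof -
  have "\<exists>L. realizer {..<2 * n} (std_rel {..<2 * n}) n L"
    using assms by (intro std_rel_realizer_lessThan) auto
  then have "\<exists>L. realizer {..<2 * n} (std_rel {..<2 * n})
      (order_dim {..<2 * n} (std_rel {..<2 * n})) L"
    unfolding order_dim_def by (rule LeastI)
  then show ?thesis using std_rel_realizer_ge by blast
qed

text \<open>\<open>c\<close> and \<open>d\<close> may be indices of no pair in \<open>Y\<close>, so
  two parts on the same side are covered as well.\<close>

lemma order_dim_std_rel_le_2:
  assumes "finite Y" and "c \<noteq> d"
    and "\<And>i. 2 * i \<in> Y \<Longrightarrow> 2 * i + 1 \<in> Y \<Longrightarrow> i = c \<or> i = d"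
  shows "order_dim Y (std_rel Y) \<le> 2"
proof -
  have set12: "{1..2} = {1, 2 :: nat}" by auto
  then have img: "(\<lambda>i :: nat. if i = 1 then c else d) ` {1..2} = {c, d}" by auto
  have "\<exists>L. realizer Y (std_rel Y) 2 L"
    by (rule std_rel_realizer[where e = "\<lambda>i. if i = 1 then c else d"])
      (use assms in \<open>auto simp: img set12 inj_on_def simp del: One_nat_def\<close>)
  then show ?thesis unfolding order_dim_def by (rule Least_le)
qed

text \<open>With no extensions at all, any two elements would vacuously be related both
  ways.\<close>

lemma order_dim_pos:
  assumes ex: "\<exists>d L. realizer Y r d L" and "antisym r" "x \<in> Y" "y \<in> Y" "x \<noteq> y"
  shows "0 < order_dim Y r"
proof (rule ccontr)
  assume "\<not> 0 < order_dim Y r"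
  moreover have "\<exists>L. realizer Y r (order_dim Y r) L"
    unfolding order_dim_def using ex by (rule LeastI_ex)
  ultimately have "(x, y) \<in> r" "(y, x) \<in> r"
    using assms by (auto simp: realizer_def)
  with assms show False by (auto dest: antisymD)
qed

lemma order_dim_std_rel_pos:
  assumes "finite Y" "x \<in> Y" "y \<in> Y" "x \<noteq> y"
  shows "0 < order_dim Y (std_rel Y)"
proof -
  obtain N where N: "\<And>y. y \<in> Y \<Longrightarrow> y < N"
    using assms(1) finite_nat_set_iff_bounded by auto
  \<comment> \<open>\<open>N\<close> bounds the indices; adding 2 meets the demand for at least two
    extensions.\<close>
  have "\<exists>L. realizer Y (std_rel Y) (N + 2) L"
    using assms by (intro std_rel_realizer_lessThan) (auto dest: N)
  then show ?thesis
    using partial_order_on_std_rel[of Y] assms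
    by (intro order_dim_pos[of _ _ x y]) (auto simp: partial_order_on_def)
qed

section \<open>Distribution of the pairs over the parts\<close>

text \<open>Write i = r + k (s + l t) with r < k, s < l, t < 2. The digit r chooses the lower part
  of a, s the upper part of b, and the free digit t leaves two pairs for each choice. Parts are
  numbered from 1, digits from 0.\<close>

definition std_part :: "nat \<Rightarrow> nat \<Rightarrow> nat \<Rightarrow> nat set" where
  "std_part k l p =
    (if p \<le> k then {2 * i | i. i < 2 * k * l \<and> i mod k = p - 1}
     else {2 * i + 1 | i. i < 2 * k * l \<and> (i div k) mod l = p - k - 1})"

lemma std_part_subset: "std_part k l p \<subseteq> {..<2 * (2 * k * l)}"
  by (auto simp: std_part_def)

lemma finite_std_part: "finite (std_part k l p)"
  by (rule finite_subset[OF std_part_subset]) simp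

lemma div_lt_double: "i < 2 * k * l \<Longrightarrow> i div k < 2 * l" for i k l :: nat
  by (rule less_mult_imp_div_less) (simp add: ac_simps)

text \<open>The witnesses are indices whose other two digits vanish: \<open>p - 1\<close> for lower
  parts, \<open>k * (p - k - 1)\<close> for upper ones.\<close>

lemma std_part_nonempty:
  assumes "0 < k" "0 < l" "p \<in> {1..k + l}"
  shows "std_part k l p \<noteq> {}"
proof (cases "p \<le> k")
  case True
  have "k * 1 \<le> k * (2 * l)" using assms by (intro mult_left_mono) auto
  moreover have "p - 1 < k" using True assms by auto
  ultimately have "p - 1 < 2 * k * l" by (simp only: mult_1_right ac_simps)
  moreover have "(p - 1) mod k = p - 1" using True assms by auto
  ultimately show ?thesis using True by (auto simp: std_part_def)
next
  case False
  have "p - k - 1 < 2 * l" using False assms by auto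
  then have "(p - k - 1) * k < 2 * l * k" using assms by simp
  then have "k * (p - k - 1) < 2 * k * l" by (simp add: ac_simps)
  moreover have "(k * (p - k - 1)) div k mod l = p - k - 1" using False assms by auto
  ultimately have "2 * (k * (p - k - 1)) + 1 \<in> std_part k l p"
    using False unfolding std_part_def if_not_P[OF False] by blast
  then show ?thesis by blast
qed

lemma parts_union_std_part:
  assumes "0 < k" "0 < l"
  shows "parts_union (k + l) (std_part k l) = {..<2 * (2 * k * l)}"
proof
  show "{..<2 * (2 * k * l)} \<subseteq> parts_union (k + l) (std_part k l)"
  proof
    fix x assume "x \<in> {..<2 * (2 * k * l)}"
    then have lt: "x div 2 < 2 * k * l" by auto
    show "x \<in> parts_union (k + l) (std_part k l)"
    proof (cases "even x")
      case True
      then have "x \<in> std_part k l (x div 2 mod k + 1)"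
        using lt assms mod_less_divisor[of k "x div 2", THEN Suc_leI]
        by (auto simp: std_part_def intro!: exI[of _ "x div 2"])
      moreover have "x div 2 mod k + 1 \<in> {1..k + l}"
        using assms mod_less_divisor[of k "x div 2"] by (auto simp del: mod_less_divisor)
      ultimately show ?thesis unfolding parts_union_def by blast
    next
      case False
      then have "x \<in> std_part k l (k + (x div 2 div k mod l) + 1)"
        using lt assms by (auto simp: std_part_def intro!: exI[of _ "x div 2"])
      moreover have "k + (x div 2 div k mod l) + 1 \<in> {1..k + l}"
        using assms mod_less_divisor[of l "x div 2 div k"] by (auto simp del: mod_less_divisor)
      ultimately show ?thesis unfolding parts_union_def by blast
    qed
  qed
qed (use std_part_subset in \<open>auto simp: parts_union_def\<close>)

lemma std_part_even_iff: "x \<in> std_part k l p \<Longrightarrow> even x \<longleftrightarrow> p \<le> k"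
  by (auto simp: std_part_def split: if_splits)

lemma disjoint_std_part: "disjoint_family_on (std_part k l) {1..k + l}"
  unfolding disjoint_family_on_def
proof (intro ballI impI)
  fix p q assume pq: "p \<in> {1..k + l}" "q \<in> {1..k + l}" "p \<noteq> q"
  have False if x: "x \<in> std_part k l p" "x \<in> std_part k l q" for x
  proof (cases "p \<le> k")
    case True
    moreover from this have "q \<le> k" using x[THEN std_part_even_iff] by simp
    ultimately have "p - 1 = q - 1" using x by (auto simp: std_part_def)
    with pq show False by auto
  next
    case False
    moreover from this have "\<not> q \<le> k" using x[THEN std_part_even_iff] by simp
    moreover from calculation have "p - k - 1 = q - k - 1" using x by (auto simp: std_part_def)
    ultimately show False using pq by auto
  qed
  then show "std_part k l p \<inter> std_part k l q = {}" by blast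
qed

lemma multipartite_poset_std:
  assumes "0 < k" "0 < l"
  shows "multipartite_poset (k + l) (std_part k l) (std_rel {..<2 * (2 * k * l)})"
  unfolding multipartite_poset_def
proof (intro conjI ballI impI allI)
  fix p x y
  assume "x \<in> std_part k l p" "y \<in> std_part k l p" "(x, y) \<in> std_rel {..<2 * (2 * k * l)}"
  then show "x = y" using std_part_even_iff[of _ k l p] by (auto simp: std_rel_def)
next
  fix x y assume xy: "(x, y) \<in> std_rel {..<2 * (2 * k * l)} \<and> x \<noteq> y"
  then have "x \<in> parts_union (k + l) (std_part k l)" "y \<in> parts_union (k + l) (std_part k l)"
    unfolding parts_union_std_part[OF assms] by (auto simp: std_rel_def)
  then obtain p q where pq: "p \<in> {1..k + l}" "q \<in> {1..k + l}"
      "x \<in> std_part k l p" "y \<in> std_part k l q"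
    unfolding parts_union_def by blast
  moreover have "p < q"
    using xy std_part_even_iff[OF pq(3)] std_part_even_iff[OF pq(4)] by (auto simp: std_rel_def)
  ultimately show "\<exists>i\<in>{1..k + l}. \<exists>j\<in>{1..k + l}. i < j \<and> x \<in> std_part k l i \<and> y \<in> std_part k l j"
    by blast
qed (use assms std_part_nonempty disjoint_std_part finite_std_part
      partial_order_on_std_rel parts_union_std_part in auto)

lemma pair_dim_std:
  assumes k: "0 < k" and l: "0 < l" and p: "p \<in> {1..k + l}" and q: "q \<in> {1..k + l}" and pq: "p < q"
  defines "d \<equiv> pair_dim (std_part k l) (std_rel {..<2 * (2 * k * l)}) p q"
  shows "d \<le> 2" "0 < d"
proof -
  let ?Y = "std_part k l p \<union> std_part k l q"
  have d: "d = order_dim ?Y (std_rel ?Y)"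
    unfolding d_def pair_dim_def by (subst std_rel_Restr) (use std_part_subset in auto)
  have fin: "finite ?Y" by (simp add: finite_std_part)
  \<comment> \<open>The index with digits \<open>p - 1\<close>, \<open>q - k - 1\<close> and top
    digit 0; raising the top digit to 1 adds \<open>k * l\<close>. If both parts lie on one side,
    they contain no pair and the value is immaterial.\<close>
  define c where "c = (p - 1) + k * (q - k - 1)"
  show "d \<le> 2"
    unfolding d
  proof (rule order_dim_std_rel_le_2[OF fin, of c "c + k * l"])
    show "c \<noteq> c + k * l" using k l by simp
    fix i assume i: "2 * i \<in> ?Y" "2 * i + 1 \<in> ?Y"
    \<comment> \<open>Each part has a single parity, so the two numbers lie in different parts;
      \<open>p < q\<close> decides which is which.\<close>
    have "p \<le> k" "2 * i \<in> std_part k l p" "\<not> q \<le> k" "2 * i + 1 \<in> std_part k l q"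
      using i pq std_part_even_iff[of "2 * i" k l p] std_part_even_iff[of "2 * i + 1" k l p]
        std_part_even_iff[of "2 * i" k l q] std_part_even_iff[of "2 * i + 1" k l q]
      by auto
    then have ilt: "i < 2 * k * l" and im: "i mod k = p - 1" and id: "i div k mod l = q - k - 1"
      by (simp_all add: std_part_def)
    \<comment> \<open>The top digit is 0 or 1.\<close>
    have "i div k div l < 2"
      using div_lt_double[OF ilt] by (simp add: less_mult_imp_div_less)
    then have "i div k div l = 0 \<or> i div k div l = 1" by linarith
    then have "i div k = i div k mod l \<or> i div k = i div k mod l + l"
      using mod_mult_div_eq[of "i div k" l] by (elim disjE) simp_all
    then have "i div k = q - k - 1 \<or> i div k = q - k - 1 + l" by (simp add: id)
    then show "i = c \<or> i = c + k * l"
      using im mod_mult_div_eq[of i k] by (auto simp: c_def algebra_simps)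
  qed
  obtain x y where "x \<in> std_part k l p" "y \<in> std_part k l q"
    using std_part_nonempty[OF k l] p q by blast
  moreover from this have "x \<noteq> y"
    using disjoint_family_onD[OF disjoint_std_part p q] pq by auto
  ultimately show "0 < d" unfolding d using order_dim_std_rel_pos[OF fin, of x y] by blast
qed

section \<open>The ratio for this poset\<close>

lemma dim_ratio_sup_ge:
  assumes k: "0 < k" and l: "0 < l"
  shows "ereal (real (k * l)) \<le> dim_ratio_sup (k + l)"
proof -
  let ?n = "2 * k * l" and ?X = "std_part k l"
  let ?r = "std_rel {..<2 * ?n}"
  let ?S = "{pair_dim ?X ?r i j | i j. i \<in> {1..k + l} \<and> j \<in> {1..k + l} \<and> i < j}"
  \<comment> \<open>This gives finiteness for \<open>Max\<close>, and the lower bound 1 rules out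
    division by zero, which would make the ratio 0.\<close>
  have "?S \<subseteq> {1..2}" using pair_dim_std[OF k l] by (fastforce simp: Suc_le_eq)
  moreover have "?S \<noteq> {}"
  proof -
    have "1 \<in> {1..k + l}" "2 \<in> {1..k + l}" "(1 :: nat) < 2" using k l by auto
    then show ?thesis by blast
  qed
  ultimately have "Max ?S \<in> {1..2}"
    by (meson Max_in finite_atLeastAtMost finite_subset subsetD)
  then have B: "0 < max_pair_dim (k + l) ?X ?r" "max_pair_dim (k + l) ?X ?r \<le> 2"
    unfolding max_pair_dim_def by auto
  have "1 \<le> k * l" using k l by (simp add: Suc_le_eq)
  then have D: "2 * (k * l) \<le> multipartite_dim (k + l) ?X ?r"
    unfolding multipartite_dim_def parts_union_std_part[OF k l]
    using order_dim_std_rel_ge[of ?n] by (simp add: mult.assoc)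
  have "real (k * l) * real (max_pair_dim (k + l) ?X ?r) \<le> real (k * l) * 2"
    using B by (intro mult_left_mono) auto
  also have "\<dots> = real (2 * (k * l))" by simp
  also have "\<dots> \<le> real (multipartite_dim (k + l) ?X ?r)" using D by (simp only: of_nat_le_iff)
  finally have "real (k * l) \<le>
      real (multipartite_dim (k + l) ?X ?r) / real (max_pair_dim (k + l) ?X ?r)"
    using B by (simp add: pos_le_divide_eq)
  then show ?thesis
    unfolding dim_ratio_sup_def
    by (intro SUP_upper2[of "(?X, ?r)"]) (use multipartite_poset_std[OF k l] in auto)
qed

section \<open>Floor and ceiling identities\<close>

lemma floor_half: "\<lfloor>real m / 2\<rfloor> = int (m div 2)"
  using floor_divide_of_nat_eq[of m 2] by simp

lemma ceiling_half: "\<lceil>real m / 2\<rceil> = int (m - m div 2)"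
proof (cases "even m")
  case True
  then obtain k where "m = 2 * k" by (rule evenE)
  then show ?thesis by simp
next
  case False
  then obtain k where "m = 2 * k + 1" by (rule oddE)
  then show ?thesis by (simp add: ceiling_eq_iff)
qed

lemma floor_square_quarter: "\<lfloor>(real m)\<^sup>2 / 4\<rfloor> = int (m div 2 * (m - m div 2))"
proof (cases "even m")
  case True
  then obtain k where "m = 2 * k" by (rule evenE)
  then show ?thesis by (simp add: power2_eq_square floor_eq_iff)
next
  case False
  then obtain k where k: "m = 2 * k + 1" by (rule oddE)
  \<comment> \<open>For odd \<open>m\<close> the remainder 1/4 disappears under the floor.\<close>
  then have "(real m)\<^sup>2 / 4 = real_of_int (int (k * (k + 1))) + 1 / 4"
    by (simp add: power2_eq_square field_simps)
  moreover have "\<lfloor>real_of_int (int (k * (k + 1))) + 1 / 4\<rfloor> = int (k * (k + 1))"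
    by (rule floor_unique) simp_all
  ultimately have "\<lfloor>(real m)\<^sup>2 / 4\<rfloor> = int (k * (k + 1))" by (simp only:)
  then show ?thesis by (simp add: k)
qed

theorem theorem2:
  fixes m :: nat
  assumes "2 \<le> m"
  shows "dim_ratio_sup m \<ge> ereal (real_of_int (\<lfloor>real m / 2\<rfloor> * \<lceil>real m / 2\<rceil>)) \<and>
         \<lfloor>real m / 2\<rfloor> * \<lceil>real m / 2\<rceil> = \<lfloor>(real m)\<^sup>2 / 4\<rfloor>"
proof -
  have "0 < m div 2" "0 < m - m div 2" "m div 2 + (m - m div 2) = m" using assms by auto
  then show ?thesis
    using dim_ratio_sup_ge[of "m div 2" "m - m div 2"]
    by (simp add: floor_half ceiling_half floor_square_quarter)
qed

end
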